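(* Let $\kappa$ be a regular uncountable cardinal with $\kappa^{<\kappa}=\kappa$. Let $R$ be a linearly ordered set with a least element $0$ such that every subset of $R$ has a greatest lower bound in $R$ and $R\setminus\{0\}$ has coinitiality $\kappa$. Then there exists an $R$-ultrametric Urysohn space $U_R$.
   Context: An $R$-ultrametric space is a set $U$ with $d\colon U\times U\to R$ satisfying $d(x,y)=0\iff x=y$, $d(x,y)=d(y,x)$, $d(x,z)\le\max(d(x,y),d(y,z))$. A sequence $(x_\alpha)_{\alpha<\lambda}$, $\lambda\le\kappa$ limit, is Cauchy if for every $r>0$ in $R$ there is $\gamma<\lambda$ with $d(x_\alpha,x_\beta)<r$ for all $\gamma<\alpha,\beta<\lambda$; $U$ is complete if every such Cauchy sequence converges. $U$ is an $R$-ultrametric Urysohn space if it is complete, has density $\le\kappa$, and has the extension property: for every $X\subseteq U$ with $|X|<\kappa$ and every $R$-ultrametric space $X\cup\{a\}$ extending the metric on $X$, there is $u\in U$ with $d(x,u)=d(x,a)$ for all $x\in X$.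
   Formalization: The formal theorem adds the hypothesis |R| ≤ κ; without it the claim fails (e.g. R = {0} + reversed κ + (κ⁺+1)), since density ≤ κ and the extension property force |R| ≤ κ. *)

theory Defs
  imports Complex_Main "HOL-Library.Lub_Glb"
begin

unbundle cardinal_syntax

text \<open>
  Cardinals and ordinals are well-orders in the sense of the BNF cardinal library: a cardinal is a
  relation \<open>\<kappa>\<close> with \<open>Card_order \<kappa>\<close>, and an ordinal at most \<open>\<kappa>\<close> is a well-order \<open>\<lambda>\<close> with
  \<open>\<lambda> \<le>o \<kappa>\<close>.  Up to isomorphism all of the latter live on the type underlying \<open>\<kappa>\<close>.
  The ordered set \<open>R\<close> is a whole type, with \<open>bot\<close> in the role of \<open>0\<close>.
\<close>

text \<open>
  The cardinal \<open>\<kappa>\<^sup><\<^sup>\<kappa>\<close> is the number of sequences of elements of \<open>\<kappa>\<close> whose length is some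
  \<open>\<alpha> < \<kappa>\<close>; the ordinals \<open>\<alpha> < \<kappa>\<close> are the elements of \<open>Field \<kappa>\<close>, and \<open>underS \<kappa> \<alpha>\<close> is the set of
  predecessors of \<open>\<alpha>\<close>.
\<close>
definition card_less_exp :: "'k rel \<Rightarrow> ('k \<times> ('k \<Rightarrow> 'k)) rel" where
  "card_less_exp \<kappa> = |SIGMA \<alpha> : Field \<kappa>. Func (underS \<kappa> \<alpha>) (Field \<kappa>)|"

definition coinitial_in :: "'r::linorder set \<Rightarrow> 'r set \<Rightarrow> bool" where
  "coinitial_in A C \<longleftrightarrow> C \<subseteq> A \<and> (\<forall>a\<in>A. \<exists>c\<in>C. c \<le> a)"

definition has_coinitiality :: "'r::linorder set \<Rightarrow> 'k rel \<Rightarrow> bool" where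
  "has_coinitiality A \<kappa> \<longleftrightarrow>
     (\<exists>C. coinitial_in A C \<and> |C| =o \<kappa>) \<and> (\<forall>C. coinitial_in A C \<longrightarrow> \<kappa> \<le>o |C| )"

definition ultrametric_space :: "'u set \<Rightarrow> ('u \<Rightarrow> 'u \<Rightarrow> 'r::{linorder,order_bot}) \<Rightarrow> bool" where
  "ultrametric_space U d \<longleftrightarrow>
     (\<forall>x\<in>U. \<forall>y\<in>U. d x y = bot \<longleftrightarrow> x = y) \<and>
     (\<forall>x\<in>U. \<forall>y\<in>U. d x y = d y x) \<and>
     (\<forall>x\<in>U. \<forall>y\<in>U. \<forall>z\<in>U. d x z \<le> max (d x y) (d y z))"

text \<open>
  A well-order is a limit ordinal if it is nonempty and has no last element, i.e. if its field is
  cofinal in the (strict) sense of the library.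
\<close>
definition limit_ordinal :: "'k rel \<Rightarrow> bool" where
  "limit_ordinal \<Lambda> \<longleftrightarrow> Well_order \<Lambda> \<and> Field \<Lambda> \<noteq> {} \<and> cofinal (Field \<Lambda>) \<Lambda>"

text \<open>Sequences indexed by the ordinal \<open>\<Lambda>\<close>; the indices greater than \<open>\<gamma>\<close> are \<open>aboveS \<Lambda> \<gamma>\<close>.\<close>

definition ultra_Cauchy ::
    "('u \<Rightarrow> 'u \<Rightarrow> 'r::{linorder,order_bot}) \<Rightarrow> 'k rel \<Rightarrow> ('k \<Rightarrow> 'u) \<Rightarrow> bool" where
  "ultra_Cauchy d \<Lambda> x \<longleftrightarrow>
     (\<forall>r>bot. \<exists>\<gamma>\<in>Field \<Lambda>. \<forall>\<alpha>\<in>aboveS \<Lambda> \<gamma>. \<forall>\<beta>\<in>aboveS \<Lambda> \<gamma>. d (x \<alpha>) (x \<beta>) < r)"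

definition ultra_converges_to ::
    "('u \<Rightarrow> 'u \<Rightarrow> 'r::{linorder,order_bot}) \<Rightarrow> 'k rel \<Rightarrow> ('k \<Rightarrow> 'u) \<Rightarrow> 'u \<Rightarrow> bool" where
  "ultra_converges_to d \<Lambda> x l \<longleftrightarrow>
     (\<forall>r>bot. \<exists>\<gamma>\<in>Field \<Lambda>. \<forall>\<alpha>\<in>aboveS \<Lambda> \<gamma>. d (x \<alpha>) l < r)"

definition ultra_complete ::
    "'k rel \<Rightarrow> 'u set \<Rightarrow> ('u \<Rightarrow> 'u \<Rightarrow> 'r::{linorder,order_bot}) \<Rightarrow> bool" where
  "ultra_complete \<kappa> U d \<longleftrightarrow>
     (\<forall>(\<Lambda> :: 'k rel) x. limit_ordinal \<Lambda> \<and> \<Lambda> \<le>o \<kappa> \<and> (\<forall>\<alpha>\<in>Field \<Lambda>. x \<alpha> \<in> U) \<and> ultra_Cauchy d \<Lambda> x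
        \<longrightarrow> (\<exists>l\<in>U. ultra_converges_to d \<Lambda> x l))"

definition ultra_dense :: "'u set \<Rightarrow> ('u \<Rightarrow> 'u \<Rightarrow> 'r::{linorder,order_bot}) \<Rightarrow> 'u set \<Rightarrow> bool" where
  "ultra_dense U d D \<longleftrightarrow> D \<subseteq> U \<and> (\<forall>x\<in>U. \<forall>r>bot. \<exists>y\<in>D. d x y < r)"

definition density_le ::
    "'k rel \<Rightarrow> 'u set \<Rightarrow> ('u \<Rightarrow> 'u \<Rightarrow> 'r::{linorder,order_bot}) \<Rightarrow> bool" where
  "density_le \<kappa> U d \<longleftrightarrow> (\<exists>D. ultra_dense U d D \<and> |D| \<le>o \<kappa>)"

text \<open>
  The one-point extension \<open>X \<union> {a}\<close> lives on the option type: \<open>Some ` X\<close> is the copy of \<open>X\<close>, and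
  \<open>None\<close> is the new point \<open>a\<close>.
\<close>
definition extension_property ::
    "'k rel \<Rightarrow> 'u set \<Rightarrow> ('u \<Rightarrow> 'u \<Rightarrow> 'r::{linorder,order_bot}) \<Rightarrow> bool" where
  "extension_property \<kappa> U d \<longleftrightarrow>
     (\<forall>X e. X \<subseteq> U \<and> |X| <o \<kappa> \<and> ultrametric_space (insert None (Some ` X)) e \<and>
            (\<forall>x\<in>X. \<forall>y\<in>X. e (Some x) (Some y) = d x y)
        \<longrightarrow> (\<exists>u\<in>U. \<forall>x\<in>X. d x u = e (Some x) None))"

definition Urysohn_space ::
    "'k rel \<Rightarrow> 'u set \<Rightarrow> ('u \<Rightarrow> 'u \<Rightarrow> 'r::{linorder,order_bot}) \<Rightarrow> bool" where
  "Urysohn_space \<kappa> U d \<longleftrightarrow>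
     ultrametric_space U d \<and> ultra_complete \<kappa> U d \<and> density_le \<kappa> U d \<and> extension_property \<kappa> U d"

text \<open>
  An \<open>R\<close>-ultrametric Urysohn space can only exist if \<open>|R| \<le> \<kappa>\<close>.  Given a point \<open>p\<close>, the extension
  property provides a point \<open>v r\<close> at distance \<open>r\<close> from \<open>p\<close> for every \<open>r\<close>.  The points \<open>v r\<close> with
  \<open>r \<ge> c > 0\<close> have mutual distances at least \<open>c\<close>, so there are at most \<open>\<kappa>\<close> of them by density; now
  let \<open>c\<close> range over a coinitial set of size \<open>\<kappa>\<close>.  Being complete and of coinitiality \<open>\<kappa>\<close> does not
  bound the size of \<open>R\<close> (put a long successor ordinal on top of a reversed copy of \<open>\<kappa>\<close>), so an
  existence theorem has to assume \<open>|R| \<le> \<kappa>\<close>.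
\<close>
lemma Urysohn_space_imp_card_le:
  fixes \<kappa> :: "'k rel" and U :: "'u set" and d :: "'u \<Rightarrow> 'u \<Rightarrow> 'r::{linorder,order_bot}"
  assumes card: "Card_order \<kappa>" and inf: "cinfinite \<kappa>"
    and coinit: "has_coinitiality (UNIV - {bot :: 'r}) \<kappa>"
    and ury: "Urysohn_space \<kappa> U d"
  shows "|UNIV :: 'r set| \<le>o \<kappa>"
proof -
  have um: "ultrametric_space U d" and den: "density_le \<kappa> U d" and ext: "extension_property \<kappa> U d"
    using ury by (auto simp: Urysohn_space_def)
  have infF: "\<not> finite (Field \<kappa>)" using inf by (simp add: cinfinite_def)
  have wo: "Well_order \<kappa>" using card by (simp add: card_order_on_well_order_on)
  have fin: "|X| <o \<kappa>" if "finite X" for X :: "'u set"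
    using finite_ordLess_infinite[OF card_of_Well_order wo] that infF by (simp add: Field_card_of)
  obtain p where p: "p \<in> U"
  proof -
    have "ultrametric_space (insert None (Some ` ({} :: 'u set))) (\<lambda>_ _. bot :: 'r)"
      by (auto simp: ultrametric_space_def)
    then have "\<exists>u\<in>U. \<forall>x\<in>{}. d x u = bot"
      using ext fin[of "{}"] unfolding extension_property_def by blast
    then show ?thesis using that by blast
  qed
  have "\<exists>u\<in>U. d p u = r" if "r \<noteq> bot" for r
  proof -
    define e where "e = (\<lambda>a b :: 'u option. if a = b then bot else r)"
    have "ultrametric_space (insert None (Some ` {p})) e"
      using that by (auto simp: ultrametric_space_def e_def)
    moreover have "d p p = bot" using um p unfolding ultrametric_space_def by blast
    then have "\<forall>x\<in>{p}. \<forall>y\<in>{p}. e (Some x) (Some y) = d x y"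
      by (simp add: e_def)
    ultimately have "\<exists>u\<in>U. \<forall>x\<in>{p}. d x u = e (Some x) None"
      using ext[unfolded extension_property_def, rule_format, of "{p}" e] fin[of "{p}"] p by simp
    then show ?thesis by (auto simp: e_def)
  qed
  then obtain v where v: "\<And>r. r \<noteq> bot \<Longrightarrow> v r \<in> U \<and> d p (v r) = r" by metis
  obtain D where D: "ultra_dense U d D" and Dk: "|D| \<le>o \<kappa>"
    using den by (auto simp: density_le_def)
  obtain C where C: "coinitial_in (UNIV - {bot :: 'r}) C" and Ck: "|C| =o \<kappa>"
    using coinit by (auto simp: has_coinitiality_def)
  have tri: "d x z \<le> max (d x y) (d y z)" if "x \<in> U" "y \<in> U" "z \<in> U" for x y z
    using um that unfolding ultrametric_space_def by blast
  have sym: "d x y = d y x" if "x \<in> U" "y \<in> U" for x y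
    using um that unfolding ultrametric_space_def by blast
  have half: "|{c..}| \<le>o \<kappa>" if c: "c \<in> C" for c
  proof -
    have "c \<noteq> bot" using c C unfolding coinitial_in_def by blast
    then have c0: "c > bot" by (simp add: bot.not_eq_extremum)
    have "\<exists>y\<in>D. d (v r) y < c" if "r \<in> {c..}" for r
    proof -
      have "r \<noteq> bot" using that c0 by auto
      then show ?thesis using v[of r] D c0 unfolding ultra_dense_def by blast
    qed
    then obtain q where q: "\<And>r. r \<ge> c \<Longrightarrow> q r \<in> D \<and> d (v r) (q r) < c"
      by (metis atLeast_iff)
    have qU: "q r \<in> U" if "r \<ge> c" for r
      using q[OF that] D by (auto simp: ultra_dense_def)
    have key: "s \<le> r" if r: "r \<ge> c" and s: "s \<ge> c" and eq: "q r = q s" for r s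
    proof (rule ccontr)
      assume "\<not> s \<le> r"
      then have rs: "r < s" by simp
      have vU: "v r \<in> U" "v s \<in> U" "d p (v r) = r" "d p (v s) = s"
        using v[of r] v[of s] r s c0 by auto
      have 1: "d (v r) (v s) \<le> max (d (v r) (q r)) (d (q r) (v s))"
        using tri vU qU[OF r] by blast
      have "d (q r) (v s) = d (v s) (q s)"
        using sym[of "q r" "v s"] eq vU qU[OF r] by simp
      then have "d (v r) (v s) < c"
        using 1 q[OF r] q[OF s] by (simp add: max_def split: if_splits)
      moreover have "d p (v s) \<le> max (d p (v r)) (d (v r) (v s))"
        using tri vU p by blast
      ultimately show False using vU rs r s by (auto simp: max_def split: if_splits)
    qed
    have "inj_on q {c..}"
      using key by (intro inj_onI) (metis antisym atLeast_iff)
    moreover have "q ` {c..} \<subseteq> D" using q by auto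
    ultimately have "|{c..}| \<le>o |D|" using card_of_ordLeq by blast
    then show ?thesis using Dk ordLeq_transitive by blast
  qed
  have C': "|C| \<le>o \<kappa>" using Ck ordIso_iff_ordLeq by blast
  have "|\<Union>c\<in>C. {c..}| \<le>o \<kappa>"
    using card_of_UNION_ordLeq_infinite_Field[OF infF card C'] half by blast
  moreover have "|{bot :: 'r}| \<le>o \<kappa>"
    by (rule ordLess_imp_ordLeq[OF finite_ordLess_infinite[OF card_of_Well_order wo _ infF]])
       (simp add: Field_card_of)
  ultimately have "|(\<Union>c\<in>C. {c..}) \<union> {bot}| \<le>o \<kappa>"
    using card_of_Un_ordLeq_infinite_Field[OF infF _ _ card] by blast
  moreover have "(UNIV :: 'r set) = (\<Union>c\<in>C. {c..}) \<union> {bot}"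
    using C by (auto simp: coinitial_in_def)
  ultimately show ?thesis by simp
qed

end

theory Submission
  imports Defs
begin

text \<open>
  The space consists of the functions \<open>f\<close> on \<open>R\<close> with values in \<open>\<kappa>\<close> whose support has fewer than
  \<open>\<kappa>\<close> elements above every positive \<open>s\<close>, and \<open>d f g\<close> is the least \<open>s\<close> such that \<open>f\<close> and \<open>g\<close> agree
  above \<open>s\<close>.  A Cauchy sequence stabilises at every positive argument.  The truncations to small
  support form a dense set of size \<open>\<kappa>\<^sup><\<^sup>\<kappa>\<close>.  For a one-point extension of a small set \<open>X\<close> with
  distances \<open>E x\<close> to the new point, glue together the tails of the \<open>x \<in> X\<close> above \<open>E x\<close>; if a
  least distance \<open>m\<close> is attained, let the glued function take at \<open>m\<close> a value which no \<open>x \<in> X\<close>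
  takes there.
\<close>

section \<open>The space of functions and its distance\<close>

definition agree_dist :: "('r::{linorder,order_bot} \<Rightarrow> 'k) \<Rightarrow> ('r \<Rightarrow> 'k) \<Rightarrow> 'r" where
  "agree_dist f g = (LEAST s. \<forall>r>s. f r = g r)"

text \<open>The element \<open>z\<close> is the default value outside the support. The distance
  never compares values at \<open>bot\<close>, so they are all fixed to be \<open>z\<close>;
  otherwise distinct functions could have distance \<open>bot\<close>.\<close>

definition small_tails :: "'k rel \<Rightarrow> 'k \<Rightarrow> ('r::{linorder,order_bot} \<Rightarrow> 'k) set" where
  "small_tails \<kappa> z = {f. range f \<subseteq> Field \<kappa> \<and> f bot = z \<and> (\<forall>s>bot. |{r. s \<le> r \<and> f r \<noteq> z}| <o \<kappa>)}"

text \<open>The bounds above which \<open>f\<close> and \<open>g\<close> agree form an upward closed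
  set. It contains its infimum \<open>m\<close>: any \<open>r\<close> above \<open>m\<close> is not
  a lower bound, so some bound lies below \<open>r\<close>, whence \<open>f r = g r\<close>. Thus
  \<open>LEAST\<close> is attained.\<close>

lemma agree_dist_le_iff:
  fixes f g :: "'r::{linorder,order_bot} \<Rightarrow> 'k"
  assumes "\<forall>S :: 'r set. \<exists>g. isGlb UNIV S g"
  shows "agree_dist f g \<le> s \<longleftrightarrow> (\<forall>r>s. f r = g r)"
proof -
  let ?P = "\<lambda>s. \<forall>r>s. f r = g r"
  obtain m where m: "isGlb UNIV (Collect ?P) m" using assms by blast
  have lb: "m \<le> s" if "?P s" for s
    using isGlbD2[OF m] that by blast
  have "?P m"
  proof (intro allI impI)
    fix r assume "m < r"
    then have "\<not> isLb UNIV (Collect ?P) r"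
      using isGlb_le_isLb[OF m] leD by blast
    then show "f r = g r" by (auto simp: isLb_def setge_def not_le)
  qed
  then have "agree_dist f g = m"
    unfolding agree_dist_def using lb by (intro Least_equality) auto
  then show ?thesis using lb \<open>?P m\<close> by force
qed

lemma ultrametric_agree_dist:
  fixes U :: "('r::{linorder,order_bot} \<Rightarrow> 'k) set"
  assumes glb: "\<forall>S :: 'r set. \<exists>g. isGlb UNIV S g"
    and U: "\<And>f. f \<in> U \<Longrightarrow> f bot = z"
  shows "ultrametric_space U (agree_dist :: ('r \<Rightarrow> 'k) \<Rightarrow> _)"
  unfolding ultrametric_space_def
proof (intro conjI ballI)
  note le = agree_dist_le_iff[OF glb]
  fix f g h :: "'r \<Rightarrow> 'k" assume fU: "f \<in> U" and gU: "g \<in> U"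
  have "agree_dist f g = bot \<longleftrightarrow> (\<forall>r>bot. f r = g r)"
    using le[of f g bot] by (simp add: bot_unique)
  also have "\<dots> \<longleftrightarrow> f = g"
    using U[OF fU] U[OF gU] by (metis bot.not_eq_extremum ext)
  finally show "agree_dist f g = bot \<longleftrightarrow> f = g" .
  show "agree_dist f g = agree_dist g f"
    unfolding agree_dist_def by (simp add: eq_commute)
  have "\<forall>r>agree_dist f g. f r = g r" "\<forall>r>agree_dist g h. g r = h r"
    using le by blast+
  then show "agree_dist f h \<le> max (agree_dist f g) (agree_dist g h)"
    unfolding le by auto
qed

text \<open>A least positive element would form a coinitial set of size one. The room below
  \<open>r\<close> serves to turn estimates \<open>\<le> s\<close> into strict ones
  \<open>< r\<close>.\<close>

lemma ex_less_if_coinitiality_infinite: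
  fixes r :: "'r::{linorder,order_bot}"
  assumes "has_coinitiality (UNIV - {bot :: 'r}) \<kappa>"
    and "Card_order \<kappa>" "infinite (Field \<kappa>)" "r > bot"
  obtains r' :: 'r where "bot < r'" "r' < r"
proof -
  have "\<not> coinitial_in (UNIV - {bot}) {r}"
  proof
    assume "coinitial_in (UNIV - {bot}) {r}"
    then have "\<kappa> \<le>o |{r}|" using assms(1) by (auto simp: has_coinitiality_def)
    then show False
      using card_of_ordLeq_finite[of "Field \<kappa>" "{r}"] card_of_Field_ordIso[OF assms(2)] assms(3)
        ordIso_ordLeq_trans by blast
  qed
  then show thesis
    using that \<open>r > bot\<close> by (auto simp: coinitial_in_def not_le) (metis bot.not_eq_extremum)
qed

section \<open>Completeness\<close>

text \<open>All terms past \<open>\<gamma> s\<close> coincide on arguments \<open>\<ge> s\<close>.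
  The pointwise limit therefore equals a single term there and inherits its small tail.\<close>

lemma complete_small_tails:
  assumes glb: "\<forall>S :: 'r::{linorder,order_bot} set. \<exists>g. isGlb UNIV S g"
    and less: "\<And>r::'r::{linorder,order_bot}. r > bot \<Longrightarrow> \<exists>r'. bot < r' \<and> r' < r"
    and z: "z \<in> Field \<kappa>"
  shows "ultra_complete \<kappa> (small_tails \<kappa> z) (agree_dist :: ('r::{linorder,order_bot} \<Rightarrow> 'k) \<Rightarrow> _)"
  unfolding ultra_complete_def
proof (intro allI impI; elim conjE)
  fix \<Lambda> :: "'k rel" and x :: "'k \<Rightarrow> 'r \<Rightarrow> 'k"
  assume lim: "limit_ordinal \<Lambda>" and xU: "\<forall>\<alpha>\<in>Field \<Lambda>. x \<alpha> \<in> small_tails \<kappa> z"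
    and "ultra_Cauchy agree_dist \<Lambda> x"
  then obtain \<gamma> where \<gamma>: "\<And>r. r > bot \<Longrightarrow> \<gamma> r \<in> Field \<Lambda>"
    and cau: "\<And>r \<alpha> \<beta>. r > bot \<Longrightarrow> \<alpha> \<in> aboveS \<Lambda> (\<gamma> r) \<Longrightarrow> \<beta> \<in> aboveS \<Lambda> (\<gamma> r) \<Longrightarrow>
      agree_dist (x \<alpha>) (x \<beta>) < r"
    unfolding ultra_Cauchy_def by metis
  have eq: "x \<alpha> r = x \<beta> r"
    if "s > bot" "s \<le> r" "\<alpha> \<in> aboveS \<Lambda> (\<gamma> s)" "\<beta> \<in> aboveS \<Lambda> (\<gamma> s)" for s r \<alpha> \<beta>
  proof -
    have "agree_dist (x \<alpha>) (x \<beta>) < r" using cau[OF that(1,3,4)] that(2) by simp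
    then show ?thesis using agree_dist_le_iff[OF glb, of "x \<alpha>" "x \<beta>"] by blast
  qed
  have "\<exists>b. b \<in> aboveS \<Lambda> a" if "a \<in> Field \<Lambda>" for a
  proof -
    have "cofinal (Field \<Lambda>) \<Lambda>" using lim by (simp add: limit_ordinal_def)
    then show ?thesis using that by (auto simp: cofinal_def aboveS_def)
  qed
  \<comment> \<open>\<open>n a\<close> is an index strictly past \<open>a\<close>; it exists because
    a limit ordinal has no last element.\<close>
  then obtain n where n: "\<And>a. a \<in> Field \<Lambda> \<Longrightarrow> n a \<in> aboveS \<Lambda> a" by metis
  define l where "l r = (if r = bot then z else x (n (\<gamma> r)) r)" for r
  have wo: "Well_order \<Lambda>" using lim by (simp add: limit_ordinal_def)
  have common: "\<exists>\<delta>. \<delta> \<in> aboveS \<Lambda> a \<and> \<delta> \<in> aboveS \<Lambda> b" if "a \<in> Field \<Lambda>" "b \<in> Field \<Lambda>" for a b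
  proof -
    have "trans \<Lambda>" "antisym \<Lambda>"
      using wo by (simp_all add: order_on_defs)
    then have "aboveS \<Lambda> b \<subseteq> aboveS \<Lambda> a" if "(a, b) \<in> \<Lambda>" for a b
      using that by (auto simp: aboveS_def dest: transD antisymD)
    moreover have "(a, b) \<in> \<Lambda> \<or> (b, a) \<in> \<Lambda>"
      using wo_rel.TOTALS[of \<Lambda>] wo that by (auto simp: wo_rel_def)
    ultimately show ?thesis using n[OF that(1)] n[OF that(2)] by blast
  qed
  have l: "l r = x \<alpha> r" if s: "s > bot" "s \<le> r" "\<alpha> \<in> aboveS \<Lambda> (\<gamma> s)" for s r \<alpha>
  proof -
    have r: "r > bot" using s by auto
    \<comment> \<open>The value \<open>l r\<close> was read off past \<open>\<gamma> r\<close>,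
      while \<open>\<alpha>\<close> lies past \<open>\<gamma> s\<close>; an index beyond both links
      them.\<close>
    then obtain \<delta> where \<delta>: "\<delta> \<in> aboveS \<Lambda> (\<gamma> s)" "\<delta> \<in> aboveS \<Lambda> (\<gamma> r)"
      using common[OF \<gamma> \<gamma>] s by blast
    have "l r = x (n (\<gamma> r)) r" using r by (auto simp: l_def)
    also have "\<dots> = x \<delta> r" using eq[OF r order.refl n[OF \<gamma>[OF r]] \<delta>(2)] .
    also have "\<dots> = x \<alpha> r" using eq[OF s(1,2) \<delta>(1) s(3)] .
    finally show ?thesis .
  qed
  have nF: "n (\<gamma> s) \<in> Field \<Lambda>" if "s > bot" for s
    using n[OF \<gamma>[OF that]] by (auto simp: aboveS_def Field_def)
  show "\<exists>l\<in>small_tails \<kappa> z. ultra_converges_to agree_dist \<Lambda> x l"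
  proof
    have "|{r. s \<le> r \<and> l r \<noteq> z}| <o \<kappa>" if s: "s > bot" for s
    proof -
      have "{r. s \<le> r \<and> l r \<noteq> z} = {r. s \<le> r \<and> x (n (\<gamma> s)) r \<noteq> z}"
        using l[OF s _ n[OF \<gamma>[OF s]]] by auto
      then show ?thesis using nF[OF s] xU s by (simp add: small_tails_def)
    qed
    moreover have "l r \<in> Field \<kappa>" for r
      using nF[of r] xU z
      by (fastforce simp: l_def small_tails_def bot.not_eq_extremum image_subset_iff)
    moreover have "l bot = z" by (simp add: l_def)
    ultimately show "l \<in> small_tails \<kappa> z" by (auto simp: small_tails_def)
    show "ultra_converges_to agree_dist \<Lambda> x l"
      unfolding ultra_converges_to_def
    proof (intro allI impI)
      fix r :: 'r assume "r > bot"
      then obtain s where s: "bot < s" "s < r" using less by blast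
      have "agree_dist (x \<alpha>) l < r" if "\<alpha> \<in> aboveS \<Lambda> (\<gamma> s)" for \<alpha>
      proof -
        have "agree_dist (x \<alpha>) l \<le> s"
          unfolding agree_dist_le_iff[OF glb] using l[OF s(1) _ that] by simp
        then show ?thesis using s by simp
      qed
      then show "\<exists>\<gamma>\<in>Field \<Lambda>. \<forall>\<alpha>\<in>aboveS \<Lambda> \<gamma>. agree_dist (x \<alpha>) l < r" using \<gamma>[OF s(1)] by blast
    qed
  qed
qed

section \<open>Counting small sets, and density\<close>

text \<open>The well-order \<open>|S|\<close> embeds into \<open>\<kappa>\<close> as a proper
  initial segment, and such a segment is some \<open>underS \<kappa> a\<close>. So \<open>S\<close>
  is enumerated by a sequence of the kind that \<open>card_less_exp\<close> counts.\<close>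

lemma ordLess_imp_bij_betw_underS:
  assumes "Card_order \<kappa>" "|S| <o \<kappa>"
  obtains a f where "a \<in> Field \<kappa>" "bij_betw f (underS \<kappa> a) S"
proof -
  have wo: "Well_order \<kappa>" using assms(1) by (simp add: card_order_on_well_order_on)
  then have rel: "wo_rel \<kappa>" by (simp add: wo_rel_def)
  obtain h where h: "embed |S| \<kappa> h"
    using ordLess_imp_ordLeq[OF assms(2)] by (auto simp: ordLeq_def)
  have inj: "inj_on h S"
    using embed_inj_on[OF card_of_Well_order h] by (simp add: Field_card_of)
  have "wo_rel.ofilter \<kappa> (h ` S)"
    using embed_Field_ofilter[OF card_of_Well_order wo h] by (simp add: Field_card_of)
  moreover have "h ` S \<noteq> Field \<kappa>"
  proof
    assume "h ` S = Field \<kappa>"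
    then have "|Field \<kappa>| \<le>o |S|" using card_of_image[of h S] by simp
    then have "\<kappa> \<le>o |S|"
      using card_of_Field_ordIso[OF assms(1)] ordIso_symmetric ordIso_ordLeq_trans by blast
    then show False using assms(2) not_ordLess_ordLeq by blast
  qed
  ultimately obtain a where a: "a \<in> Field \<kappa>" "h ` S = underS \<kappa> a"
    using wo_rel.ofilter_underS_Field[OF rel] by auto
  have "bij_betw (inv_into S h) (underS \<kappa> a) S"
    using inj a(2) by (intro bij_betw_inv_into) (simp add: bij_betw_def)
  then show thesis using that a(1) by blast
qed

lemma card_of_small_subsets_ordLeq:
  assumes "Card_order \<kappa>" "card_less_exp \<kappa> =o \<kappa>"
  shows "|{S. S \<subseteq> Field \<kappa> \<and> |S| <o \<kappa>}| \<le>o \<kappa>"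
proof -
  let ?F = "SIGMA a : Field \<kappa>. Func (underS \<kappa> a) (Field \<kappa>)"
  have "{S. S \<subseteq> Field \<kappa> \<and> |S| <o \<kappa>} \<subseteq> (\<lambda>(a, f). f ` underS \<kappa> a) ` ?F"
  proof
    fix S assume "S \<in> {S. S \<subseteq> Field \<kappa> \<and> |S| <o \<kappa>}"
    then have S: "S \<subseteq> Field \<kappa>" "|S| <o \<kappa>" by auto
    obtain a f where a: "a \<in> Field \<kappa>" and f: "bij_betw f (underS \<kappa> a) S"
      using ordLess_imp_bij_betw_underS[OF assms(1) S(2)] by blast
    \<comment> \<open>Members of \<open>Func\<close> must be \<open>undefined\<close> outside their
      domain.\<close>
    let ?g = "\<lambda>b. if b \<in> underS \<kappa> a then f b else undefined"
    have im: "f ` underS \<kappa> a = S" using f by (simp add: bij_betw_def)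
    then have "(a, ?g) \<in> ?F" using a S(1) by (auto simp: Func_def)
    moreover have "S = (case (a, ?g) of (a, f) \<Rightarrow> f ` underS \<kappa> a)" using im by auto
    ultimately show "S \<in> (\<lambda>(a, f). f ` underS \<kappa> a) ` ?F" by (rule rev_image_eqI)
  qed
  then have "|{S. S \<subseteq> Field \<kappa> \<and> |S| <o \<kappa>}| \<le>o |?F|"
    by (rule ordLeq_transitive[OF card_of_mono1 card_of_image])
  then show ?thesis
    by (rule ordLeq_ordIso_trans) (rule assms(2)[unfolded card_less_exp_def])
qed

text \<open>A function is determined by its graph over its support. Since
  \<open>|R| \<le> \<kappa>\<close>, an injection \<open>j\<close> of
  \<open>R \<times> \<kappa>\<close> into \<open>\<kappa>\<close> codes these graphs as small
  subsets of \<open>Field \<kappa>\<close>.\<close>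

lemma card_of_small_support_ordLeq:
  assumes card: "Card_order \<kappa>" and inf: "infinite (Field \<kappa>)"
    and exp: "card_less_exp \<kappa> =o \<kappa>" and R: "|UNIV :: 'r set| \<le>o \<kappa>"
  shows "|{f :: 'r \<Rightarrow> 'k. range f \<subseteq> Field \<kappa> \<and> |{r. f r \<noteq> z}| <o \<kappa>}| \<le>o \<kappa>" (is "|?D| \<le>o \<kappa>")
proof -
  have F: "|Field \<kappa>| =o \<kappa>" using card_of_Field_ordIso[OF card] .
  have "|(UNIV :: 'r set) \<times> Field \<kappa>| \<le>o \<kappa>"
    using card_of_Times_ordLeq_infinite_Field[OF inf R _ card] F ordIso_imp_ordLeq by blast
  then have "|(UNIV :: 'r set) \<times> Field \<kappa>| \<le>o |Field \<kappa>|"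
    using F ordIso_symmetric ordLeq_ordIso_trans by blast
  then obtain j :: "'r \<times> 'k \<Rightarrow> 'k"
    where j: "inj_on j (UNIV \<times> Field \<kappa>)" "j ` (UNIV \<times> Field \<kappa>) \<subseteq> Field \<kappa>"
    using card_of_ordLeq by metis
  define G where "G f = (\<lambda>r. (r, f r)) ` {r. f r \<noteq> z}" for f :: "'r \<Rightarrow> 'k"
  have G: "G f \<subseteq> UNIV \<times> Field \<kappa>" if "f \<in> ?D" for f
    using that by (auto simp: G_def)
  have "inj_on (\<lambda>f. j ` G f) ?D"
  proof (rule inj_onI)
    fix f g assume fg: "f \<in> ?D" "g \<in> ?D" and "j ` G f = j ` G g"
    then have "G f = G g" using inj_on_image_eq_iff[OF j(1)] G by blast
    moreover have "(r, k) \<in> G f \<longleftrightarrow> k = f r \<and> k \<noteq> z" for f r k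
      by (auto simp: G_def)
    ultimately have "f r = g r" for r by metis
    then show "f = g" by blast
  qed
  moreover have "(\<lambda>f. j ` G f) ` ?D \<subseteq> {S. S \<subseteq> Field \<kappa> \<and> |S| <o \<kappa>}"
  proof (rule image_subsetI)
    fix f assume f: "f \<in> ?D"
    have "j ` G f \<subseteq> Field \<kappa>" using G[OF f] j(2) by blast
    moreover have "|j ` G f| \<le>o |{r. f r \<noteq> z}|"
      unfolding G_def image_image by (rule card_of_image)
    then have "|j ` G f| <o \<kappa>" using f ordLeq_ordLess_trans by blast
    ultimately show "j ` G f \<in> {S. S \<subseteq> Field \<kappa> \<and> |S| <o \<kappa>}" by simp
  qed
  ultimately have "|?D| \<le>o |{S. S \<subseteq> Field \<kappa> \<and> |S| <o \<kappa>}|" using card_of_ordLeq by blast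
  then show ?thesis using card_of_small_subsets_ordLeq[OF card exp] ordLeq_transitive by blast
qed

lemma density_small_tails:
  assumes glb: "\<forall>S :: 'r::{linorder,order_bot} set. \<exists>g. isGlb UNIV S g"
    and less: "\<And>r::'r::{linorder,order_bot}. r > bot \<Longrightarrow> \<exists>r'. bot < r' \<and> r' < r"
    and card: "Card_order \<kappa>" "infinite (Field \<kappa>)"
    and exp: "card_less_exp \<kappa> =o \<kappa>" and R: "|UNIV :: 'r::{linorder,order_bot} set| \<le>o \<kappa>"
    and z: "z \<in> Field \<kappa>"
  shows "density_le \<kappa> (small_tails \<kappa> z) (agree_dist :: ('r::{linorder,order_bot} \<Rightarrow> 'k) \<Rightarrow> _)"
proof -
  define D where "D = {f \<in> small_tails \<kappa> z. |{r::'r::{linorder,order_bot}. f r \<noteq> z}| <o \<kappa>}"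
  have "ultra_dense (small_tails \<kappa> z) agree_dist D"
    unfolding ultra_dense_def
  proof (intro conjI ballI allI impI)
    show "D \<subseteq> small_tails \<kappa> z" by (auto simp: D_def)
    fix f :: "'r \<Rightarrow> 'k" and r :: 'r assume f: "f \<in> small_tails \<kappa> z" and "r > bot"
    then obtain s where s: "bot < s" "s < r" using less by blast
    \<comment> \<open>The whole support of the truncation is one tail of \<open>f\<close>, hence
      small, and the two functions can differ only below \<open>s\<close>.\<close>
    define g where "g t = (if s \<le> t then f t else z)" for t
    have supp: "{t. g t \<noteq> z} = {t. s \<le> t \<and> f t \<noteq> z}" by (auto simp: g_def)
    have small: "|{t. g t \<noteq> z}| <o \<kappa>"
      unfolding supp using f s by (simp add: small_tails_def)
    have "|{t. u \<le> t \<and> g t \<noteq> z}| <o \<kappa>" for u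
      by (rule ordLeq_ordLess_trans[OF card_of_mono1 small]) auto
    moreover have "range g \<subseteq> Field \<kappa>" using f z by (auto simp: g_def small_tails_def)
    moreover have "g bot = z" using f by (simp add: g_def small_tails_def)
    ultimately have "g \<in> D" using small by (simp add: D_def small_tails_def)
    moreover have "agree_dist f g \<le> s"
      unfolding agree_dist_le_iff[OF glb] by (auto simp: g_def)
    then have "agree_dist f g < r" using s by simp
    ultimately show "\<exists>y\<in>D. agree_dist f y < r" by blast
  qed
  moreover have "|D| \<le>o |{f :: 'r \<Rightarrow> 'k. range f \<subseteq> Field \<kappa> \<and> |{r. f r \<noteq> z}| <o \<kappa>}|"
    by (rule card_of_mono1) (auto simp: D_def small_tails_def)
  then have "|D| \<le>o \<kappa>"
    using card_of_small_support_ordLeq[OF card exp R] ordLeq_transitive by blast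
  ultimately show ?thesis unfolding density_le_def by blast
qed

section \<open>Extension property\<close>

text \<open>The tails are compatible because the ultrametric inequality through the new point makes
  \<open>x\<close> and \<open>y\<close> agree above \<open>max (E x) (E y)\<close>. Coinitiality
  puts a positive \<open>a\<close> below all \<open>E x\<close>, and regularity then keeps the union
  of the supports above \<open>a\<close> small.\<close>

lemma extension_small_tails:
  assumes glb: "\<forall>S :: 'r::{linorder,order_bot} set. \<exists>g. isGlb UNIV S g"
    and card: "Card_order \<kappa>" and reg: "regularCard \<kappa>" and inf: "infinite (Field \<kappa>)"
    and coinit: "has_coinitiality (UNIV - {bot :: 'r::{linorder,order_bot}}) \<kappa>"
    and z: "z \<in> Field \<kappa>"
  shows "extension_property \<kappa> (small_tails \<kappa> z) (agree_dist :: ('r::{linorder,order_bot} \<Rightarrow> 'k) \<Rightarrow> _)"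
  unfolding extension_property_def
proof (intro allI impI; elim conjE)
  fix X :: "('r \<Rightarrow> 'k) set" and e :: "('r \<Rightarrow> 'k) option \<Rightarrow> ('r \<Rightarrow> 'k) option \<Rightarrow> 'r"
  assume XU: "X \<subseteq> small_tails \<kappa> z" and Xk: "|X| <o \<kappa>"
    and um: "ultrametric_space (insert None (Some ` X)) e"
    and ed: "\<forall>x\<in>X. \<forall>y\<in>X. e (Some x) (Some y) = agree_dist x y"
  note le = agree_dist_le_iff[OF glb]
  define E where "E x = e (Some x) None" for x
  have E0: "E x \<noteq> bot" if "x \<in> X" for x
    using um that unfolding ultrametric_space_def E_def by blast
  have tri: "E x \<le> max (agree_dist x y) (E y)" "agree_dist x y \<le> max (E x) (E y)"
    if "x \<in> X" "y \<in> X" for x y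
  proof -
    have "e (Some x) None \<le> max (e (Some x) (Some y)) (e (Some y) None)"
      and "e (Some x) (Some y) \<le> max (e (Some x) None) (e None (Some y))"
      and "e None (Some y) = e (Some y) None"
      using um that unfolding ultrametric_space_def by blast+
    then show "E x \<le> max (agree_dist x y) (E y)" "agree_dist x y \<le> max (E x) (E y)"
      using ed that by (simp_all add: E_def)
  qed
  have small_image: "|F ` X| <o \<kappa>" for F :: "_ \<Rightarrow> 'b"
    using card_of_image Xk ordLeq_ordLess_trans by blast
  obtain a where a: "a > bot" "\<And>x. x \<in> X \<Longrightarrow> a < E x"
  proof -
    \<comment> \<open>Fewer than \<open>\<kappa>\<close> distances cannot be coinitial among the
      positive elements.\<close>
    have "\<not> \<kappa> \<le>o |E ` X|" using small_image not_ordLess_ordLeq by blast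
    then have "\<not> coinitial_in (UNIV - {bot}) (E ` X)"
      using coinit by (auto simp: has_coinitiality_def)
    moreover have "E ` X \<subseteq> UNIV - {bot}" using E0 by auto
    ultimately obtain a where "a \<noteq> bot" "\<And>x. x \<in> X \<Longrightarrow> a < E x"
      by (auto simp: coinitial_in_def not_le)
    then show thesis using that by (simp add: bot.not_eq_extremum)
  qed
  have "\<exists>c\<in>Field \<kappa>. c \<notin> (\<lambda>x. x r) ` X" for r
  proof (rule ccontr)
    assume "\<not> ?thesis"
    then have "Field \<kappa> \<subseteq> (\<lambda>x. x r) ` X" by blast
    then have "|Field \<kappa>| <o \<kappa>" using small_image card_of_mono1 ordLeq_ordLess_trans by blast
    then show False using card_of_Field_ordIso[OF card] not_ordLess_ordIso by blast
  qed
  then obtain c where c: "\<And>r. c r \<in> Field \<kappa>" "\<And>r x. x \<in> X \<Longrightarrow> x r \<noteq> c r"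
    by (metis image_eqI)
  \<comment> \<open>The second case arises only when \<open>r\<close> is the least value of
    \<open>E\<close> on \<open>X\<close>. The choice made by \<open>SOME\<close> is immaterial,
    since all candidates agree at \<open>r\<close>.\<close>
  define u where "u r = (if \<exists>x\<in>X. E x < r then (SOME x. x \<in> X \<and> E x < r) r
    else if \<exists>x\<in>X. E x = r then c r else z)" for r
  have u_some: "\<exists>y\<in>X. E y < r \<and> u r = y r" if "x \<in> X" "E x < r" for x r
    using someI[of "\<lambda>x. x \<in> X \<and> E x < r", OF conjI[OF that]] that
    by (intro bexI[of _ "SOME x. x \<in> X \<and> E x < r"]) (auto simp: u_def)
  have u: "u r = x r" if x: "x \<in> X" "E x < r" for x r
  proof -
    obtain y where y: "y \<in> X" "E y < r" "u r = y r" using u_some[OF x] by blast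
    have "agree_dist x y \<le> max (E x) (E y)" using tri x y by blast
    then show ?thesis using x y unfolding le by auto
  qed
  have dist: "agree_dist x u = E x" if x: "x \<in> X" for x
  proof (rule antisym)
    show xu: "agree_dist x u \<le> E x" unfolding le using u[OF x] by simp
    show "E x \<le> agree_dist x u"
    proof (cases "\<exists>y\<in>X. E y < E x")
      case True
      then obtain y where y: "y \<in> X" "E y < E x" by blast
      \<comment> \<open>Here \<open>y\<close> is nearer to the new point than \<open>x\<close>. As
        \<open>u\<close> follows \<open>y\<close> above \<open>E y\<close>, a distance from
        \<open>x\<close> to \<open>u\<close> below \<open>E x\<close> would bring \<open>x\<close>
        and \<open>y\<close> closer than \<open>E x\<close>.\<close>
      have xy: "E x \<le> agree_dist x y" using tri(1)[OF x y(1)] y(2) by (auto simp: le_max_iff_disj)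
      show ?thesis
      proof (rule ccontr)
        assume "\<not> ?thesis"
        moreover have "agree_dist x y \<le> max (agree_dist x u) (E y)"
          unfolding le
        proof (intro allI impI)
          fix r assume "max (agree_dist x u) (E y) < r"
          moreover have "\<forall>r>agree_dist x u. x r = u r" using le by blast
          ultimately show "x r = y r" using u[OF y(1)] by auto
        qed
        ultimately show False using xy y(2) by (auto simp: max_def split: if_splits)
      qed
    next
      case False
      \<comment> \<open>Now \<open>E x\<close> is the least distance, and the fresh value there
        separates \<open>u\<close> from \<open>x\<close>.\<close>
      then have "u (E x) = c (E x)" using x by (auto simp: u_def)
      then have "x (E x) \<noteq> u (E x)" using c(2) x by metis
      then show ?thesis using le[of x u "agree_dist x u"] by (meson not_le order.refl)
    qed
  qed
  have "|{r. s \<le> r \<and> u r \<noteq> z}| <o \<kappa>" for s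
  proof -
    let ?A = "\<lambda>x. {r. a \<le> r \<and> x r \<noteq> z}"
    \<comment> \<open>The bound is independent of \<open>s\<close>: where \<open>u\<close> differs
      from \<open>z\<close>, either it copies some \<open>x\<close> above \<open>E x\<close>, hence
      above \<open>a\<close>, or \<open>r\<close> is itself a distance.\<close>
    have "{r. s \<le> r \<and> u r \<noteq> z} \<subseteq> (\<Union>x\<in>X. ?A x) \<union> E ` X"
    proof
      fix r assume r: "r \<in> {r. s \<le> r \<and> u r \<noteq> z}"
      show "r \<in> (\<Union>x\<in>X. ?A x) \<union> E ` X"
      proof (cases "\<exists>x\<in>X. E x < r")
        case True
        then obtain x where x: "x \<in> X" "E x < r" by blast
        then have "r \<in> ?A x" using a(2)[OF x(1)] u[OF x] r by auto
        then show ?thesis using x(1) by blast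
      next
        case False
        then show ?thesis using r by (auto simp: u_def split: if_splits)
      qed
    qed
    moreover have "\<forall>x\<in>X. |?A x| <o \<kappa>"
      using XU a(1) by (auto simp: small_tails_def)
    then have "|\<Union>x\<in>X. ?A x| <o \<kappa>"
      using card_of_UNION_ordLess_infinite_Field_regularCard[OF reg _ Xk] card inf
      by (simp add: cinfinite_def)
    then have "|(\<Union>x\<in>X. ?A x) \<union> E ` X| <o \<kappa>"
      using card_of_Un_ordLess_infinite_Field[OF inf card] small_image by blast
    ultimately show ?thesis using card_of_mono1 ordLeq_ordLess_trans by blast
  qed
  moreover have "u r \<in> Field \<kappa>" for r
  proof (cases "\<exists>x\<in>X. E x < r")
    case True
    then show ?thesis using u XU by (fastforce simp: small_tails_def)
  next
    case False
    then show ?thesis using c(1) z by (simp add: u_def)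
  qed
  moreover have "u bot = z" using E0 by (auto simp: u_def)
  ultimately have "u \<in> small_tails \<kappa> z" by (auto simp: small_tails_def)
  then show "\<exists>u\<in>small_tails \<kappa> z. \<forall>x\<in>X. agree_dist x u = e (Some x) None"
    using dist by (auto simp: E_def)
qed

theorem theorem5p4:
  fixes \<kappa> :: "'k rel"
  assumes "Card_order \<kappa>" and "regularCard \<kappa>" and "natLeq <o \<kappa>"
    and "card_less_exp \<kappa> =o \<kappa>"
    and "\<forall>S :: 'r::{linorder,order_bot} set. \<exists>g. isGlb UNIV S g"
    and "has_coinitiality (UNIV - {bot :: 'r}) \<kappa>"
    and "|UNIV :: 'r set| \<le>o \<kappa>"
  shows "\<exists>(U :: ('r \<Rightarrow> 'k) set) (d :: ('r \<Rightarrow> 'k) \<Rightarrow> ('r \<Rightarrow> 'k) \<Rightarrow> 'r). Urysohn_space \<kappa> U d"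
proof -
  have inf: "infinite (Field \<kappa>)"
    using natLeq_ordLeq_cinfinite assms(1,3) ordLess_imp_ordLeq cinfinite_mono natLeq_cinfinite
    unfolding cinfinite_def by blast
  then obtain z where z: "z \<in> Field \<kappa>" by fastforce
  have less: "\<exists>r'. bot < r' \<and> r' < r" if "r > bot" for r :: 'r
    using ex_less_if_coinitiality_infinite[OF assms(6,1) inf that] by blast
  have "Urysohn_space \<kappa> (small_tails \<kappa> z) (agree_dist :: ('r \<Rightarrow> 'k) \<Rightarrow> _)"
    unfolding Urysohn_space_def
    using ultrametric_agree_dist[OF assms(5), of "small_tails \<kappa> z" z]
      complete_small_tails[OF assms(5) less z]
      density_small_tails[OF assms(5) less assms(1) inf assms(4,7) z]
      extension_small_tails[OF assms(5,1,2) inf assms(6) z]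
    by (simp add: small_tails_def)
  then show ?thesis by blast
qed

end
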